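(* For the makespan recovery problem with a single perturbation, the recovery strategy has an $\Omega(m)$ price of robustness when the initial schedule is an arbitrary optimal one. That is, there is a constant $c>0$ such that for all sufficiently large $m$ there exist an instance $I_{init}$ of $P||C_{\max}$ with $m$ machines, a minimum makespan schedule $S_{init}$ for $I_{init}$, and an instance $I_{new}$ obtained from $I_{init}$ by a single perturbation, such that the schedule $S_{rec}$ for $I_{new}$ produced from $S_{init}$ by the recovery strategy satisfies $$C_{\max}(S_{rec})\ge c\,m\cdot C_{\max}(S_{new})>0,$$ where $S_{new}$ is a minimum makespan schedule for $I_{new}$.
   Context: $P||C_{\max}$: an instance $(m,\mathcal{J})$ consists of a set $\mathcal{M}$ of $m\ge 1$ parallel identical machines and a finite set $\mathcal{J}$ of jobs with processing times $p_j>0$. A schedule $S$ assigns each job to exactly one machine; the completion time $C_i(S)$ of machine $M_i$ is the sum of the processing times of its jobs, and the makespan is $C_{\max}(S)=\max_i C_i(S)$. Single perturbation: $I_{new}$, with machine set $\hat{\mathcal{M}}\neq\emptyset$ and job set $\hat{\mathcal{J}}$ with processing times $\hat p_j$, is obtained from $I_{init}$ by exactly one of: (1) the processing time of one job $J_j\in\mathcal{J}$ is reduced to $\hat p_j=p_j/f_j$ with $f_j>1$; (2) the processing time of one job $J_j\in\mathcal{J}$ is augmented to $\hat p_j=f_jp_j$ with $f_j>1$; (3) one job of $\mathcal{J}$ is cancelled (removed); (4) one new job arrives; (5) one machine of $\mathcal{M}$ fails (is removed); (6) one new machine is activated (added). Everything else is unchanged. Recovery strategy: (1) every job $J_j\in\mathcal{J}\cap\hat{\mathcal{J}}$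 that $S_{init}$ assigns to a machine in $\mathcal{M}\cap\hat{\mathcal{M}}$ stays on that machine (with its new processing time $\hat p_j$); (2) all other jobs of $\hat{\mathcal{J}}$ (new jobs and jobs whose machine failed) are then assigned one by one in non-increasing order of processing time, each to a currently least loaded machine of $\hat{\mathcal{M}}$ (Longest Processing Time first; ties broken arbitrarily). Price of robustness: the worst-case ratio $C_{\max}(S_{rec})/C_{\max}(S_{new})$. *)

theory Defs
  imports "HOL-Analysis.Analysis"
begin

(* The values of ptime outside jobs, and likewise those of a schedule, carry no meaning. *)
record ('m, 'j) pcmax =
  machines :: "'m set"
  jobs :: "'j set"
  ptime :: "'j \<Rightarrow> real"

definition is_instance :: "('m, 'j) pcmax \<Rightarrow> bool" where
  "is_instance I \<longleftrightarrow>
     finite (machines I) \<and> machines I \<noteq> {} \<and> finite (jobs I) \<and> (\<forall>j\<in>jobs I. ptime I j > 0)"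

definition is_schedule :: "('m, 'j) pcmax \<Rightarrow> ('j \<Rightarrow> 'm) \<Rightarrow> bool" where
  "is_schedule I S \<longleftrightarrow> S \<in> jobs I \<rightarrow> machines I"

(* The job set A is a parameter because list scheduling looks at partially built schedules. *)
definition load :: "('m, 'j) pcmax \<Rightarrow> ('j \<Rightarrow> 'm) \<Rightarrow> 'j set \<Rightarrow> 'm \<Rightarrow> real" where
  "load I S A i = (\<Sum>j\<in>{j\<in>A. S j = i}. ptime I j)"

definition completion :: "('m, 'j) pcmax \<Rightarrow> ('j \<Rightarrow> 'm) \<Rightarrow> 'm \<Rightarrow> real" where
  "completion I S i = load I S (jobs I) i"

definition makespan :: "('m, 'j) pcmax \<Rightarrow> ('j \<Rightarrow> 'm) \<Rightarrow> real" where
  "makespan I S = Max (completion I S ` machines I)"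

definition optimal_schedule :: "('m, 'j) pcmax \<Rightarrow> ('j \<Rightarrow> 'm) \<Rightarrow> bool" where
  "optimal_schedule I S \<longleftrightarrow> is_arg_min (makespan I) (is_schedule I) S"

inductive perturbation :: "('m, 'j) pcmax \<Rightarrow> ('m, 'j) pcmax \<Rightarrow> bool" for I where
  job_reduced: "j \<in> jobs I \<Longrightarrow> f > 1 \<Longrightarrow>
    perturbation I (I\<lparr>ptime := (ptime I)(j := ptime I j / f)\<rparr>)"
| job_augmented: "j \<in> jobs I \<Longrightarrow> f > 1 \<Longrightarrow>
    perturbation I (I\<lparr>ptime := (ptime I)(j := f * ptime I j)\<rparr>)"
| job_cancelled: "j \<in> jobs I \<Longrightarrow>
    perturbation I (I\<lparr>jobs := jobs I - {j}\<rparr>)"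
| job_arrived: "j \<notin> jobs I \<Longrightarrow> p > 0 \<Longrightarrow>
    perturbation I (I\<lparr>jobs := insert j (jobs I), ptime := (ptime I)(j := p)\<rparr>)"
| machine_failed: "i \<in> machines I \<Longrightarrow> machines I - {i} \<noteq> {} \<Longrightarrow>
    perturbation I (I\<lparr>machines := machines I - {i}\<rparr>)"
| machine_activated: "i \<notin> machines I \<Longrightarrow>
    perturbation I (I\<lparr>machines := insert i (machines I)\<rparr>)"

definition kept_jobs ::
  "('m, 'j) pcmax \<Rightarrow> ('m, 'j) pcmax \<Rightarrow> ('j \<Rightarrow> 'm) \<Rightarrow> 'j set" where
  "kept_jobs I I' S = {j \<in> jobs I \<inter> jobs I'. S j \<in> machines I \<inter> machines I'}"

(* xs is the order in which the remaining jobs are assigned. Just before xs ! k is placed,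
   exactly the kept jobs and the first k elements of xs are on the machines. All ways of
   breaking ties, in the order and in the choice of machine, are admitted. *)
definition recovery ::
  "('m, 'j) pcmax \<Rightarrow> ('j \<Rightarrow> 'm) \<Rightarrow> ('m, 'j) pcmax \<Rightarrow> ('j \<Rightarrow> 'm) \<Rightarrow> bool" where
  "recovery I S I' R \<longleftrightarrow>
     (\<forall>j\<in>kept_jobs I I' S. R j = S j) \<and>
     (\<exists>xs. distinct xs \<and> set xs = jobs I' - kept_jobs I I' S \<and>
           sorted_wrt (\<lambda>a b. ptime I' a \<ge> ptime I' b) xs \<and>
           (\<forall>k<length xs.
              is_arg_min (load I' R (kept_jobs I I' S \<union> set (take k xs)))
                (\<lambda>i. i \<in> machines I') (R (xs ! k))))"

lemma is_instance_perturbation: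
  assumes "perturbation I I'" and "is_instance I"
  shows "is_instance I'"
  using assms by cases (auto simp: is_instance_def)

lemma is_schedule_recovery:
  assumes "recovery I S I' R"
  shows "is_schedule I' R"
proof -
  from assms obtain xs where keep: "\<forall>j\<in>kept_jobs I I' S. R j = S j"
    and xs: "set xs = jobs I' - kept_jobs I I' S"
    and place: "\<forall>k<length xs. R (xs ! k) \<in> machines I'"
    by (auto simp: recovery_def is_arg_min_def)
  have "R j \<in> machines I'" if "j \<in> jobs I'" for j
  proof (cases "j \<in> kept_jobs I I' S")
    case True
    with keep show ?thesis by (simp add: kept_jobs_def)
  next
    case False
    with that xs have "j \<in> set xs" by simp
    with place show ?thesis by (metis in_set_conv_nth)
  qed
  then show ?thesis by (simp add: is_schedule_def)
qed

end

theory Submission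
  imports Defs
begin

text \<open>One job of length m alone on a machine makes it optimal to put m unit jobs together on a
  second machine. Once the long job is cancelled, the optimum drops to 1, whereas the recovery
  strategy leaves all unit jobs where they are.\<close>

lemma makespan_ge_completion:
  assumes "is_instance I" and "i \<in> machines I"
  shows "completion I S i \<le> makespan I S"
  using assms by (simp add: makespan_def is_instance_def)

lemma makespan_ge_ptime:
  assumes I: "is_instance I" and S: "is_schedule I S" and j: "j \<in> jobs I"
  shows "ptime I j \<le> makespan I S"
proof -
  have "ptime I j \<le> completion I S (S j)"
    unfolding completion_def load_def
    by (rule member_le_sum) (use I j in \<open>auto simp: is_instance_def less_imp_le\<close>)
  also have "\<dots> \<le> makespan I S"
    using I S j by (intro makespan_ge_completion) (auto simp: is_schedule_def)
  finally show ?thesis .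
qed

lemma makespan_eq_ptime:
  assumes "is_instance I" and "is_schedule I S" and "j \<in> jobs I"
    and "\<And>i. i \<in> machines I \<Longrightarrow> completion I S i \<le> ptime I j"
  shows "makespan I S = ptime I j"
proof (rule antisym)
  show "makespan I S \<le> ptime I j"
    using assms(1,4) by (simp add: makespan_def is_instance_def)
qed (use assms in \<open>simp add: makespan_ge_ptime\<close>)

text \<open>Whatever the schedule, some machine must process \<open>j\<close> in full, so
  \<open>ptime I j\<close> bounds every makespan from below. Attaining this bound certifies
  optimality. The certificate is the long job before the perturbation and a unit job after
  it.\<close>

lemma optimal_scheduleI:
  assumes "is_instance I" and "is_schedule I S" and "j \<in> jobs I"
    and "makespan I S = ptime I j"
  shows "optimal_schedule I S"
  using assms makespan_ge_ptime[OF assms(1) _ assms(3)]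
  by (auto simp: optimal_schedule_def is_arg_min_def not_less)

text \<open>The list of jobs left to assign has an empty set of elements, so it is \<open>[]\<close>
  and the list scheduling phase is vacuous. Tie-breaking therefore cannot affect the
  outcome.\<close>

lemma recovery_all_kept:
  assumes "kept_jobs I I' S = jobs I'"
  shows "recovery I S I' R \<longleftrightarrow> (\<forall>j\<in>jobs I'. R j = S j)"
  using assms by (auto simp: recovery_def)

theorem theorem3:
  shows "\<exists>c>0::real. \<forall>\<^sub>F m in sequentially.
    \<exists>(I_init :: (nat, nat) pcmax) S_init I_new S_new.
      is_instance I_init \<and> card (machines I_init) = m \<and>
      optimal_schedule I_init S_init \<and>
      perturbation I_init I_new \<and>
      optimal_schedule I_new S_new \<and>
      (\<exists>S_rec. recovery I_init S_init I_new S_rec) \<and>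
      (\<forall>S_rec. recovery I_init S_init I_new S_rec \<longrightarrow>
         makespan I_new S_rec \<ge> c * real m * makespan I_new S_new \<and>
         c * real m * makespan I_new S_new > 0)"
proof (intro exI[of _ "1::real"] conjI eventually_sequentiallyI[of 2])
  fix m :: nat
  \<comment> \<open>The threshold 2 provides machine 1, which takes the unit jobs while machine 0
    takes the long one.\<close>
  assume m: "2 \<le> m"
  define I :: "(nat, nat) pcmax" where
    \<comment> \<open>There are m machines but m + 1 jobs: job 0 is the long one, jobs 1 to m are
      the unit jobs.\<close>
    "I = \<lparr>machines = {..<m}, jobs = {..m}, ptime = (\<lambda>j. if j = 0 then real m else 1)\<rparr>"
  define S :: "nat \<Rightarrow> nat" where "S j = (if j = 0 then 0 else 1)" for j
  define I' where "I' = I\<lparr>jobs := jobs I - {0}\<rparr>"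
  \<comment> \<open>The shift maps the surviving jobs 1 to m bijectively onto the machines 0 to m -
    1.\<close>
  define S' :: "nat \<Rightarrow> nat" where "S' j = j - 1" for j

  have inst: "is_instance I"
    using m by (auto simp: is_instance_def I_def lessThan_empty_iff)
  have pert: "perturbation I I'"
    unfolding I'_def by (rule job_cancelled) (simp add: I_def)
  have inst': "is_instance I'"
    using pert inst by (rule is_instance_perturbation)
  have jobs': "jobs I' = {1..m}"
    by (auto simp: I'_def I_def)

  have sched: "is_schedule I S"
    using m by (auto simp: is_schedule_def I_def S_def)
  \<comment> \<open>Machines 0 and 1 both have load exactly m, and all others are empty.\<close>
  have compl: "completion I S i \<le> ptime I 0" for i
  proof -
    have "{j \<in> {..m}. S j = i} = (if i = 0 then {0} else if i = 1 then {1..m} else {})"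
      by (auto simp: S_def split: if_splits)
    then show ?thesis
      by (simp add: completion_def load_def I_def)
  qed
  have job0: "0 \<in> jobs I"
    by (simp add: I_def)
  have opt: "optimal_schedule I S"
    using inst sched job0 makespan_eq_ptime[OF inst sched job0 compl]
    by (rule optimal_scheduleI)

  have sched': "is_schedule I' S'"
    using m by (auto simp: is_schedule_def I'_def I_def S'_def)
  have compl': "completion I' S' i \<le> ptime I' 1" if "i \<in> machines I'" for i
  proof -
    \<comment> \<open>Subtraction on \<open>nat\<close> truncates only at 0, which is not a
      surviving job; \<open>i < m\<close> puts \<open>Suc i\<close> in the range.\<close>
    have "{j \<in> {1..m}. S' j = i} = {Suc i}"
      using that by (auto simp: S'_def I'_def I_def)
    then show ?thesis
      by (simp add: completion_def load_def jobs') (simp add: I'_def I_def)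
  qed
  have job1: "1 \<in> jobs I'"
    using m by (simp add: jobs')
  have ms': "makespan I' S' = ptime I' 1"
    using inst' sched' job1 compl' by (rule makespan_eq_ptime)
  have opt': "optimal_schedule I' S'"
    using inst' sched' job1 ms' by (rule optimal_scheduleI)
  have ms1: "makespan I' S' = 1"
    using ms' by (simp add: I'_def I_def)

  \<comment> \<open>Cancelling a job removes no machine, so every surviving job stays where
    \<open>S\<close> put it.\<close>
  have "kept_jobs I I' S = jobs I'"
    using m by (auto simp: kept_jobs_def I'_def I_def S_def)
  note rec = recovery_all_kept[OF this]
  \<comment> \<open>An arbitrary recovered schedule \<open>R\<close> agrees with \<open>S\<close> on
    the surviving jobs, so machine 1 still carries all m unit jobs.\<close>
  have big: "real m \<le> makespan I' R" if "recovery I S I' R" for R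
  proof -
    have "{j \<in> {1..m}. R j = 1} = {1..m}"
      using that by (auto simp: rec jobs' S_def)
    then have "completion I' R 1 = (\<Sum>j\<in>{1..m}. ptime I' j)"
      by (simp add: completion_def load_def jobs')
    also have "\<dots> = (\<Sum>j\<in>{1..m}. 1)"
      by (rule sum.cong) (auto simp: I'_def I_def)
    finally have "completion I' R 1 = real m"
      by simp
    moreover have "1 \<in> machines I'"
      using m by (simp add: I'_def I_def)
    ultimately show ?thesis
      using makespan_ge_completion[OF inst'] by metis
  qed

  show "\<exists>(I_init :: (nat, nat) pcmax) S_init I_new S_new.
      is_instance I_init \<and> card (machines I_init) = m \<and>
      optimal_schedule I_init S_init \<and>
      perturbation I_init I_new \<and>
      optimal_schedule I_new S_new \<and>
      (\<exists>S_rec. recovery I_init S_init I_new S_rec) \<and>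
      (\<forall>S_rec. recovery I_init S_init I_new S_rec \<longrightarrow>
         makespan I_new S_rec \<ge> 1 * real m * makespan I_new S_new \<and>
         1 * real m * makespan I_new S_new > 0)"
  proof (rule exI[of _ I], rule exI[of _ S], rule exI[of _ I'], rule exI[of _ S'],
      intro exI[of _ S] conjI allI impI)
    show "card (machines I) = m"
      by (simp add: I_def)
    show "recovery I S I' S"
      by (simp add: rec)
  \<comment> \<open>As the new optimum is 1, the ratio bound is \<open>big\<close> and positivity is
    just \<open>m > 0\<close>.\<close>
  qed (use inst opt pert opt' big ms1 m in simp_all)
qed simp

end
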